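(* Let $v$ be a positive integer. If a completely quasi-uniform nested $\mathrm{SQS}(v)$ exists, then $v \equiv 4 \pmod{6}$ and the multiplicity of each pair is either $\frac{v-4}{6}$ or $\frac{v+2}{6}$. More precisely, in a completely quasi-uniform nested $\mathrm{SQS}(v)$ there are exactly $\frac{v(v-1)}{3}$ pairs with multiplicity $\frac{v-4}{6}$ and exactly $\frac{v(v-1)}{6}$ pairs with multiplicity $\frac{v+2}{6}$.
   Context: A Steiner quadruple system $\mathrm{SQS}(v)$ is a pair $(V,\mathcal{B})$ where $V$ is a set of $v$ points and $\mathcal{B}$ is a collection of $4$-subsets of $V$ (blocks) such that every $3$-subset of $V$ lies in exactly one block; it is known that an $\mathrm{SQS}(v)$ exists if and only if $v \equiv 2$ or $4 \pmod 6$. A nested $\mathrm{SQS}(v)$ is a pair $(V,\mathscr{B})$ where $\mathscr{B}$ is a set of unordered pairs $\{\{x,y\},\{z,w\}\}$ of $2$-subsets of $V$ (written $\{x,y\mid z,w\}$, called nested blocks) such that $(V,\mathcal{B})$ with $\mathcal{B}=\{\{x,y,z,w\} : \{x,y\mid z,w\}\in\mathscr{B}\}$ is an $\mathrm{SQS}(v)$; i.e. each block of an SQS is partitioned into two pairs (nested pairs). The multiplicity of a pair $\{x,y\}\in\binom{V}{2}$ is the number of nested blocks in $\mathscr{B}$ having $\{x,y\}$ as one of its two pairs. A nested SQS is quasi-uniform if the multiplicities of the nested pairs (pairs with positive multiplicity) are not all equal but any two of them differ by at most one; it is completely quasi-uniform if moreover every pair in $\binom{V}{2}$ has positive multiplicity.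 *)

theory Defs
  imports Complex_Main "HOL-Library.Ramsey" "HOL-Number_Theory.Cong"
begin

text \<open>The library notation \<^term>\<open>[V]\<^bsup>k\<^esup>\<close> stands for the set of all \<open>k\<close>-subsets of \<open>V\<close>.\<close>

definition steiner_quadruple_system :: "nat \<Rightarrow> 'a set \<Rightarrow> 'a set set \<Rightarrow> bool" where
  "steiner_quadruple_system v V B \<longleftrightarrow>
     finite V \<and> card V = v \<and> B \<subseteq> [V]\<^bsup>4\<^esup> \<and>
     (\<forall>T \<in> [V]\<^bsup>3\<^esup>. \<exists>!b. b \<in> B \<and> T \<subseteq> b)"

text \<open>
  A nested block \<open>{x,y | z,w}\<close> is the set \<open>{{x,y}, {z,w}}\<close>, and its underlying block is the
  union \<open>{x,y,z,w}\<close>. That the two pairs are disjoint follows from the underlying block being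
  a 4-set. Injectivity of the union says that each block is partitioned into two pairs in
  exactly one way, so that nested blocks and blocks correspond one to one.
\<close>

definition nested_sqs :: "nat \<Rightarrow> 'a set \<Rightarrow> 'a set set set \<Rightarrow> bool" where
  "nested_sqs v V N \<longleftrightarrow>
     (\<forall>P \<in> N. \<exists>e \<in> [V]\<^bsup>2\<^esup>. \<exists>f \<in> [V]\<^bsup>2\<^esup>. P = {e, f}) \<and>
     inj_on \<Union> N \<and>
     steiner_quadruple_system v V (\<Union> ` N)"

definition multiplicity_of_pair :: "'a set set set \<Rightarrow> 'a set \<Rightarrow> nat" where
  "multiplicity_of_pair N e = card {P \<in> N. e \<in> P}"

definition nested_pairs :: "'a set \<Rightarrow> 'a set set set \<Rightarrow> 'a set set" where
  "nested_pairs V N = {e \<in> [V]\<^bsup>2\<^esup>. multiplicity_of_pair N e > 0}"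

definition quasi_uniform :: "nat \<Rightarrow> 'a set \<Rightarrow> 'a set set set \<Rightarrow> bool" where
  "quasi_uniform v V N \<longleftrightarrow>
     nested_sqs v V N \<and>
     \<not> (\<forall>e \<in> nested_pairs V N. \<forall>f \<in> nested_pairs V N.
          multiplicity_of_pair N e = multiplicity_of_pair N f) \<and>
     (\<forall>e \<in> nested_pairs V N. \<forall>f \<in> nested_pairs V N.
          \<bar>int (multiplicity_of_pair N e) - int (multiplicity_of_pair N f)\<bar> \<le> 1)"

definition completely_quasi_uniform :: "nat \<Rightarrow> 'a set \<Rightarrow> 'a set set set \<Rightarrow> bool" where
  "completely_quasi_uniform v V N \<longleftrightarrow>
     quasi_uniform v V N \<and> (\<forall>e \<in> [V]\<^bsup>2\<^esup>. multiplicity_of_pair N e > 0)"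

end

theory Submission
  imports Defs
begin

text \<open>
  Counting triples above a fixed set shows that an SQS on \<open>v\<close> points has \<open>v(v-1)(v-2)/24\<close> blocks and
  that \<open>v\<close> is \<open>2\<close> or \<open>4\<close> modulo \<open>6\<close>. Each block contributes two nested pairs, so over all pairs the
  multiplicity averages to \<open>(v-2)/6\<close>. If exactly two consecutive multiplicities occur, this average
  is not an integer, which excludes \<open>v = 2\<close> modulo \<open>6\<close>; for \<open>v = 6k + 4\<close> the average is \<open>k + 1/3\<close>,
  so the multiplicities are \<open>k\<close> and \<open>k + 1\<close> and one third of the pairs attain the larger one.
\<close>

lemma card_supersets_of_card:
  assumes "finite X" "S \<subseteq> X" "card S \<le> k"
  shows "card {T. S \<subseteq> T \<and> T \<subseteq> X \<and> card T = k} = (card X - card S) choose (k - card S)"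
proof -
  have fS: "finite S" using assms finite_subset by blast
  have "bij_betw (\<lambda>T. T - S) {T. S \<subseteq> T \<and> T \<subseteq> X \<and> card T = k}
          {U. U \<subseteq> X - S \<and> card U = k - card S}"
  proof (rule bij_betw_byWitness[where f' = "\<lambda>U. U \<union> S"])
    show "(\<lambda>T. T - S) ` {T. S \<subseteq> T \<and> T \<subseteq> X \<and> card T = k} \<subseteq> {U. U \<subseteq> X - S \<and> card U = k - card S}"
      using fS by (auto simp: card_Diff_subset)
    show "(\<lambda>U. U \<union> S) ` {U. U \<subseteq> X - S \<and> card U = k - card S}
            \<subseteq> {T. S \<subseteq> T \<and> T \<subseteq> X \<and> card T = k}"
    proof clarsimp
      fix U assume U: "U \<subseteq> X - S" "card U = k - card S"
      then have "finite U" "U \<inter> S = {}" using assms(1) finite_subset by blast+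
      then show "U \<subseteq> X \<and> S \<subseteq> X \<and> card (U \<union> S) = k"
        using U assms fS by (auto simp: card_Un_disjoint)
    qed
  qed auto
  then have "card {T. S \<subseteq> T \<and> T \<subseteq> X \<and> card T = k} = card {U. U \<subseteq> X - S \<and> card U = k - card S}"
    by (rule bij_betw_same_card)
  also have "\<dots> = (card X - card S) choose (k - card S)"
    using assms fS by (simp add: n_subsets card_Diff_subset)
  finally show ?thesis .
qed

text \<open>Double counting of the pairs \<open>(T, b)\<close> with
  \<open>S \<subseteq> T \<subseteq> b\<close> and \<open>card T = 3\<close>: each triple
  \<open>T\<close> lies in exactly one block, and each block above \<open>S\<close> contains the
  same number of such triples. The sizes 0, 1 and 2 of \<open>S\<close> are the ones used
  below.\<close>

lemma sqs_card_blocks_containing: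
  assumes "steiner_quadruple_system v V B" "S \<subseteq> V" "card S \<le> 3"
  shows "card {b \<in> B. S \<subseteq> b} * ((4 - card S) choose (3 - card S)) = (v - card S) choose (3 - card S)"
proof -
  let ?T = "{T. S \<subseteq> T \<and> T \<subseteq> V \<and> card T = 3}"
  let ?C = "{b \<in> B. S \<subseteq> b}"
  have V: "finite V" "card V = v" and B: "\<And>b. b \<in> B \<Longrightarrow> b \<subseteq> V \<and> finite b \<and> card b = 4"
    and ex1: "\<And>T. T \<subseteq> V \<Longrightarrow> finite T \<Longrightarrow> card T = 3 \<Longrightarrow> \<exists>!b. b \<in> B \<and> T \<subseteq> b"
    using assms(1) by (auto simp: steiner_quadruple_system_def nsets_def)
  have fT: "finite ?T" using V by auto
  have "B \<subseteq> Pow V" using B by blast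
  then have fC: "finite ?C" using V finite_subset by fastforce
  have "(\<Sum>T\<in>?T. card {b \<in> ?C. T \<subseteq> b}) = (\<Sum>b\<in>?C. (4 - card S) choose (3 - card S))"
  proof (rule sum_multicount_gen[OF fT fC], intro ballI)
    fix b assume b: "b \<in> ?C"
    then have "{T \<in> ?T. T \<subseteq> b} = {T. S \<subseteq> T \<and> T \<subseteq> b \<and> card T = 3}" using B by blast
    then show "card {T \<in> ?T. T \<subseteq> b} = (4 - card S) choose (3 - card S)"
      using card_supersets_of_card[of b S 3] b B assms(3) by simp
  qed
  moreover have "card {b \<in> ?C. T \<subseteq> b} = 1" if "T \<in> ?T" for T
  proof -
    have "T \<subseteq> V" "finite T" "card T = 3" using that V by (auto intro: finite_subset)
    from ex1[OF this] have "card {b \<in> B. T \<subseteq> b} = 1"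
      by (simp add: card_1_singleton_iff Ex1_def) blast
    moreover have "{b \<in> ?C. T \<subseteq> b} = {b \<in> B. T \<subseteq> b}" using that by blast
    ultimately show ?thesis by simp
  qed
  ultimately show ?thesis
    using card_supersets_of_card[of V S 3] V assms by simp
qed

lemma sqs_card_blocks:
  assumes "steiner_quadruple_system v V B"
  shows "card B * 4 = v choose 3"
  using sqs_card_blocks_containing[OF assms, of "{}"] by (simp add: numeral_eq_Suc)

lemma choose_three_times_three: "(n choose 3) * 3 = (n - 2) * (n choose 2)"
  using binomial_absorption[of 2 n] binomial_absorb_comp[of n 2] by simp

lemma sqs_order_mod_6:
  assumes "steiner_quadruple_system v V B" "2 \<le> v"
  shows "v mod 6 = 2 \<or> v mod 6 = 4"
proof -
  have V: "finite V" "card V = v" using assms(1) by (auto simp: steiner_quadruple_system_def)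
  obtain S where S: "S \<subseteq> V" "card S = 2"
    using obtain_subset_with_card_n[of 2 V] V assms(2) by blast
  \<comment> \<open>For a pair the identity reads: twice the number of blocks above \<open>S\<close>
    is \<open>v - 2\<close>.\<close>
  have "even (v - 2)"
    using sqs_card_blocks_containing[OF assms(1) S(1)] S(2) by (simp add: numeral_eq_Suc) presburger
  then have ev: "even v" using assms(2) by presburger
  obtain R where R: "R \<subseteq> V" "card R = 1"
    using obtain_subset_with_card_n[of 1 V] V assms(2) by auto
  obtain r where "r * 3 = (v - 1) choose 2"
    using sqs_card_blocks_containing[OF assms(1) R(1)] R(2) by (auto simp: numeral_eq_Suc)
  then have r: "r * 6 = (v - 1) * (v - 2)"
    using binomial_absorption[of 1 "v - 1"] by (simp add: numeral_2_eq_2)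
  have "v mod 3 \<noteq> 0"
  proof
    assume "v mod 3 = 0"
    then obtain k where k: "v = 3 * k" by auto
    then obtain j where j: "v = 3 * Suc j" using assms(2) by (cases k) auto
    \<comment> \<open>Writing \<open>v\<close> as \<open>3 * j + 3\<close> makes both subtractions
      exact; the product is then 2 modulo 3, whereas \<open>r\<close> makes it a multiple of
      6.\<close>
    have "(v - 1) * (v - 2) = 3 * (j * (3 * j + 3)) + 2" by (simp add: j algebra_simps)
    then show False using r by presburger
  qed
  then show ?thesis using ev by presburger
qed

lemma nested_sqs_finite:
  assumes "nested_sqs v V N"
  shows "finite N"
proof -
  have "finite V" "\<Union> ` N \<subseteq> Pow V" "inj_on \<Union> N"
    using assms unfolding nested_sqs_def steiner_quadruple_system_def nsets_def by blast+
  then show ?thesis by (meson finite_Pow_iff finite_imageD finite_subset)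
qed

lemma nested_sqs_sum_multiplicity:
  assumes "nested_sqs v V N"
  shows "(\<Sum>e\<in>[V]\<^bsup>2\<^esup>. multiplicity_of_pair N e) = 2 * card N"
proof -
  have V: "finite V" using assms by (simp add: nested_sqs_def steiner_quadruple_system_def)
  have "(\<Sum>e\<in>[V]\<^bsup>2\<^esup>. card {P \<in> N. e \<in> P}) = (\<Sum>P\<in>N. 2)"
  proof (rule sum_multicount_gen[OF _ _ ballI])
    show "finite ([V]\<^bsup>2\<^esup>)" using V by (rule finite_imp_finite_nsets)
    show "finite N" using assms by (rule nested_sqs_finite)
    fix P assume P: "P \<in> N"
    then have "\<exists>e\<in>[V]\<^bsup>2\<^esup>. \<exists>f\<in>[V]\<^bsup>2\<^esup>. P = {e, f}"
      using assms by (simp add: nested_sqs_def)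
    then obtain e f where ef: "e \<in> [V]\<^bsup>2\<^esup>" "f \<in> [V]\<^bsup>2\<^esup>" "P = {e, f}"
      by (elim bexE)
    \<comment> \<open>If the two pairs coincided, the union would have only two points.\<close>
    have "card (\<Union> P) = 4"
      using P assms by (auto simp: nested_sqs_def steiner_quadruple_system_def nsets_def)
    then have "e \<noteq> f" using ef by (auto simp: nsets_def)
    moreover have "{e \<in> [V]\<^bsup>2\<^esup>. e \<in> P} = {e, f}" using ef by auto
    ultimately show "card {e \<in> [V]\<^bsup>2\<^esup>. e \<in> P} = 2" by simp
  qed
  then show ?thesis by (simp add: multiplicity_of_pair_def)
qed

text \<open>The multiplicities sum to twice the number of blocks, so six times the sum is
  \<open>3 * (v choose 3)\<close>. The factor 6 keeps the average \<open>(v - 2) / 6\<close> within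
  the natural numbers.\<close>

lemma nested_sqs_average_multiplicity:
  assumes "nested_sqs v V N"
  shows "6 * (\<Sum>e\<in>[V]\<^bsup>2\<^esup>. multiplicity_of_pair N e) = (v - 2) * card ([V]\<^bsup>2\<^esup>)"
proof -
  have "card (\<Union> ` N) = card N" and sqs: "steiner_quadruple_system v V (\<Union> ` N)"
    using assms by (auto simp: nested_sqs_def card_image)
  moreover have "card V = v" using sqs by (simp add: steiner_quadruple_system_def)
  ultimately show ?thesis
    using nested_sqs_sum_multiplicity[OF assms] sqs_card_blocks[OF sqs] choose_three_times_three[of v]
    by simp
qed

lemma two_consecutive_values:
  fixes f :: "'a \<Rightarrow> nat"
  assumes "\<not> (\<forall>x\<in>A. \<forall>y\<in>A. f x = f y)"
    and "\<forall>x\<in>A. \<forall>y\<in>A. \<bar>int (f x) - int (f y)\<bar> \<le> 1"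
  obtains m where "\<forall>x\<in>A. f x = m \<or> f x = Suc m" "\<exists>x\<in>A. f x = m" "\<exists>x\<in>A. f x = Suc m"
proof -
  obtain x y where xy: "x \<in> A" "y \<in> A" "f x < f y"
    using assms(1) by (metis linorder_neqE_nat)
  \<comment> \<open>The values at \<open>x\<close> and \<open>y\<close> are consecutive, and any
    value within distance 1 of both is one of the two.\<close>
  have "f z = f x \<or> f z = Suc (f x)" if "z \<in> A" for z
    using assms(2)[rule_format, OF that xy(1)] assms(2)[rule_format, OF that xy(2)]
      assms(2)[rule_format, OF xy(1,2)] xy(3) by linarith
  then show thesis using that[of "f x"] xy by (metis less_irrefl)
qed

text \<open>Both \<open>c\<close> and \<open>p - c\<close> are positive, so \<open>m\<close> is the floor of the average \<open>(v-2)/6\<close>.\<close>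

lemma quasi_uniform_average:
  fixes v m p c :: nat
  assumes "6 * (m * p + c) = (v - 2) * p" "0 < c" "c < p" "v mod 6 = 2 \<or> v mod 6 = 4"
  shows "v = 6 * m + 4" "3 * c = p"
proof -
  obtain k r where k: "v - 2 = 6 * k + r" "v = 6 * k + r + 2" "r = 0 \<or> r = 2"
  proof (rule that[of "v div 6" "v mod 6 - 2"])
  qed (use assms(4) in presburger)+
  have e: "6 * (m * p) + 6 * c = 6 * (k * p) + r * p"
    using assms(1) k(1) by (simp add: algebra_simps)
  \<comment> \<open>If \<open>k < m\<close>, the left side of \<open>e\<close> exceeds the right by
    at least \<open>4 * p + 6 * c\<close>; if \<open>m < k\<close>, the right side exceeds the left
    by at least \<open>6 * (p - c)\<close>.\<close>
  have "k = m"
  proof (rule linorder_cases[of k m])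
    assume "k < m"
    then have "Suc k * p \<le> m * p" by (intro mult_le_mono1) simp
    moreover have "r * p \<le> 2 * p" using k(3) by auto
    ultimately show ?thesis using e assms(2,3) by simp
  next
    assume "m < k"
    then have "Suc m * p \<le> k * p" by (intro mult_le_mono1) simp
    then show ?thesis using e assms(3) by simp
  qed
  \<comment> \<open>What remains of \<open>e\<close> is \<open>6 * c = r * p\<close>; since
    \<open>c\<close> is positive, \<open>r\<close> is 2.\<close>
  then show "v = 6 * m + 4" "3 * c = p" using e k assms(2) by auto
qed

theorem theorem2p1:
  fixes v :: nat and V :: "'a set" and N :: "'a set set set"
  assumes "v > 0"
    and "completely_quasi_uniform v V N"
  shows "[v = 4] (mod 6)
    \<and> (\<forall>e \<in> [V]\<^bsup>2\<^esup>.
          real (multiplicity_of_pair N e) = (real v - 4) / 6 \<or>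
          real (multiplicity_of_pair N e) = (real v + 2) / 6)
    \<and> real (card {e \<in> [V]\<^bsup>2\<^esup>. real (multiplicity_of_pair N e) = (real v - 4) / 6})
        = real v * (real v - 1) / 3
    \<and> real (card {e \<in> [V]\<^bsup>2\<^esup>. real (multiplicity_of_pair N e) = (real v + 2) / 6})
        = real v * (real v - 1) / 6"
proof -
  let ?E = "[V]\<^bsup>2\<^esup>"
  let ?mu = "multiplicity_of_pair N"
  have nested: "nested_sqs v V N" and pairs: "nested_pairs V N = ?E"
    using assms(2) by (auto simp: completely_quasi_uniform_def quasi_uniform_def nested_pairs_def)
  have "\<not> (\<forall>e\<in>?E. \<forall>f\<in>?E. ?mu e = ?mu f)" "\<forall>e\<in>?E. \<forall>f\<in>?E. \<bar>int (?mu e) - int (?mu f)\<bar> \<le> 1"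
    using assms(2) unfolding completely_quasi_uniform_def quasi_uniform_def pairs by blast+
  then obtain m where m: "\<forall>e\<in>?E. ?mu e = m \<or> ?mu e = Suc m" "\<exists>e\<in>?E. ?mu e = m" "\<exists>e\<in>?E. ?mu e = Suc m"
    by (rule two_consecutive_values)
  have sqs: "steiner_quadruple_system v V (\<Union> ` N)" using nested by (simp add: nested_sqs_def)
  then have V: "finite V" "card V = v" by (auto simp: steiner_quadruple_system_def)
  have fE: "finite ?E" using V by (simp add: finite_imp_finite_nsets)
  \<comment> \<open>Some pair attains the value \<open>m\<close>, so \<open>V\<close> has at least
    two points.\<close>
  have "2 \<le> v" using m(2) V by (auto simp: nsets_def dest: card_mono)
  define A where "A = {e \<in> ?E. ?mu e = m}"
  define C where "C = {e \<in> ?E. ?mu e = Suc m}"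
  have AC: "finite A" "finite C" "A \<inter> C = {}" "A \<union> C = ?E" "A \<noteq> {}" "C \<noteq> {}"
    using fE m by (auto simp: A_def C_def)
  then have cAC: "card ?E = card A + card C" using card_Un_disjoint by metis
  have "sum ?mu ?E = sum ?mu A + sum ?mu C" using AC sum.union_disjoint by metis
  also have "\<dots> = m * card ?E + card C" by (simp add: A_def C_def cAC[unfolded A_def C_def] algebra_simps del: card_nsets)
  finally have "6 * (m * card ?E + card C) = (v - 2) * card ?E"
    using nested_sqs_average_multiplicity[OF nested] by simp
  moreover have "0 < card C" "card C < card ?E" using AC cAC by (auto simp: card_gt_0_iff)
  ultimately have v: "v = 6 * m + 4" and C3: "3 * card C = card ?E"
    using quasi_uniform_average sqs_order_mod_6[OF sqs \<open>2 \<le> v\<close>] by blast+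
  have "2 * card ?E = v * (v - 1)"
    using V binomial_absorption[of 1 v] by (simp add: numeral_2_eq_2)
  then have "2 * real (card ?E) = real v * real (v - 1)"
    by (metis of_nat_mult of_nat_numeral)
  then have "2 * real (card ?E) = real v * (real v - 1)"
    using assms(1) by (simp add: of_nat_diff del: card_nsets)
  \<comment> \<open>With \<open>v = 6 * m + 4\<close> the two fractions are exactly \<open>m\<close>
    and \<open>m + 1\<close>.\<close>
  moreover have "{e \<in> ?E. real (?mu e) = (real v - 4) / 6} = A"
    "{e \<in> ?E. real (?mu e) = (real v + 2) / 6} = C"
    by (auto simp: A_def C_def v field_simps)
  moreover have "\<forall>e\<in>?E. real (?mu e) = (real v - 4) / 6 \<or> real (?mu e) = (real v + 2) / 6"
    using m(1) by (auto simp: v field_simps)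
  moreover have "[v = 4] (mod 6)" by (simp add: v cong_def)
  \<comment> \<open>\<open>C\<close> is a third of the \<open>v * (v - 1) / 2\<close> pairs and
    \<open>A\<close> the other two thirds.\<close>
  ultimately show ?thesis using C3 cAC by auto
qed

end
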